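(* Let $d\ge1$, let $\Psi\in\mathcal B_0$ be strictly increasing in $(0,\infty)$, $V\in L^\infty(\mathbb R^d)$, let $\mathcal D\subset\mathbb R^d$ be a bounded convex open set, and let $\varphi$ be a non-zero solution of $$(\Psi(-\Delta)+V)\varphi=\lambda\varphi \ \text{ in } \mathcal D,\qquad \varphi=0 \ \text{ in } \mathcal D^c,$$ with eigenvalue $\lambda\in\mathbb R$, such that $|\varphi|$ attains a global maximum at some $x^*\in\mathcal D$. Then $$|\mathcal D|\,\left(\Psi^{-1}\Big(\frac{\|V^-\|_\infty-\inf_{\mathcal D}V^+ +\lambda}{\theta}\Big)\right)^{d/2}\ \ge\ \omega_d ,$$ where $|\mathcal D|$ is the Lebesgue measure of $\mathcal D$, $\omega_d$ is the volume of the unit ball of $\mathbb R^d$, and $$\theta=-\min_{\kappa>1}\frac1\kappa\log\big(1-F(-1)(1-e^{1-\kappa})\big)\approx0.0833,$$ with $F$ the distribution function of a Gaussian random variable with mean $0$ and variance $2$.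
   Context: $\mathcal B_0$ is the set of Bernstein functions vanishing at zero: $f\in C^\infty((0,\infty))$, $f\ge0$, $(-1)^n f^{(n)}\le 0$ for all $n\ge1$, and $\lim_{u\downarrow0}f(u)=0$. $\Psi(-\Delta)$ is the operator with Fourier multiplier $\Psi(|y|^2)$. Let $(S^\Psi_t)_{t\ge0}$ be the subordinator with $\mathbb E[e^{-uS^\Psi_t}]=e^{-t\Psi(u)}$, $(B_t)_{t\ge0}$ an independent $d$-dimensional Brownian motion running twice as fast as standard Brownian motion, and $X_t=B_{S^\Psi_t}$; $\mathbb E^x$ is expectation for $X$ started at $x$. $V^+=\max\{V,0\}$, $V^-=\max\{-V,0\}$. With $\tau_{\mathcal D}=\inf\{t>0: X_t\notin\mathcal D\}$, set $T^{\mathcal D,V}_tf(x)=\mathbb E^x\big[e^{-\int_0^tV(X_s)ds}f(X_t)\mathbf 1_{\{\tau_{\mathcal D}>t\}}\big]$, $x\in\mathcal D$; this semigroup has generator $-H^{\mathcal D,V}$, where $H^{\mathcal D,V}$ is the Friedrichs extension of $(\Psi(-\Delta)+V)|_{C_c^\infty(\mathcal D)}$. A non-zero solution $\varphi$ with eigenvalue $\lambda$ is a non-zero $\varphi\in L^2(\mathcal D)$ (extended by $0$ outside $\mathcal D$) with $H^{\mathcal D,V}\varphi=\lambda\varphi$, i.e. $T^{\mathcal D,V}_t\varphi=e^{-\lambda t}\varphi$ for all $t>0$, taken in the version for which this identity holds at every $x\in\mathcal D$. If $\Psi$ is bounded and the argument of $\Psi^{-1}$ is not in the range of $\Psi$,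 then $\Psi^{-1}$ is read as $+\infty$. *)

theory Defs
  imports "HOL-Probability.Probability"
begin

section \<open>Bernstein functions\<close>

text \<open>The class \<open>\<B>\<^sub>0\<close>. Only the values on \<open>(0, \<infinity>)\<close> matter; the iterated derivatives at a point
  \<open>u > 0\<close> depend only on the function near \<open>u\<close>.\<close>

definition bernstein0 :: "(real \<Rightarrow> real) \<Rightarrow> bool" where
  "bernstein0 \<Psi> \<longleftrightarrow>
     (\<forall>n. \<forall>u>0. (deriv ^^ n) \<Psi> differentiable (at u)) \<and>
     (\<forall>u>0. 0 \<le> \<Psi> u) \<and>
     (\<forall>n\<ge>1. \<forall>u>0. (-1) ^ n * (deriv ^^ n) \<Psi> u \<le> 0) \<and>
     (\<Psi> \<longlongrightarrow> 0) (at_right 0)"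

text \<open>The inverse of \<open>\<Psi> : (0, \<infinity>) \<rightarrow> (0, sup \<Psi>)\<close>. Arguments above the range give \<open>\<infinity>\<close>. Arguments
  \<open>a \<le> 0\<close>, which lie below the range, give \<open>0 = \<Psi>\<^sup>-\<^sup>1(0)\<close>, so that a lower bound for \<open>inv_\<Psi> a\<close>
  never holds merely because \<open>a\<close> is not positive.\<close>

definition bernstein_inv :: "(real \<Rightarrow> real) \<Rightarrow> real \<Rightarrow> ennreal" where
  "bernstein_inv \<Psi> a =
     (if a \<in> \<Psi> ` {0<..} then ennreal (the_inv_into {0<..} \<Psi> a)
      else if a \<le> 0 then 0 else \<infinity>)"

text \<open>Real powers on \<open>[0, \<infinity>]\<close>, for exponents \<open>p > 0\<close>.\<close>

definition ennreal_powr :: "ennreal \<Rightarrow> real \<Rightarrow> ennreal" where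
  "ennreal_powr x p = (if x = \<infinity> then \<infinity> else ennreal (enn2real x powr p))"


section \<open>Subordinate Brownian motion\<close>

text \<open>Processes are indexed by real times, of which only the times \<open>t \<ge> 0\<close> are used.\<close>

definition indep_increments :: "'w measure \<Rightarrow> (real \<Rightarrow> 'w \<Rightarrow> 'a::euclidean_space) \<Rightarrow> bool" where
  "indep_increments M X \<longleftrightarrow>
     (\<forall>(n::nat) (t::nat \<Rightarrow> real). 0 \<le> t 0 \<and> (\<forall>i<n. t i \<le> t (Suc i)) \<longrightarrow>
        prob_space.indep_vars M (\<lambda>_. borel) (\<lambda>i \<omega>. X (t (Suc i)) \<omega> - X (t i) \<omega>) {..<n})"

definition subordinator :: "'w measure \<Rightarrow> (real \<Rightarrow> real) \<Rightarrow> (real \<Rightarrow> 'w \<Rightarrow> real) \<Rightarrow> bool" where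
  "subordinator M \<Psi> S \<longleftrightarrow>
     (\<forall>t\<ge>0. S t \<in> borel_measurable M) \<and>
     (AE \<omega> in M. S 0 \<omega> = 0 \<and> mono_on {0..} (\<lambda>t. S t \<omega>) \<and>
        (\<forall>t\<ge>0. continuous (at_right t) (\<lambda>t. S t \<omega>))) \<and>
     indep_increments M S \<and>
     (\<forall>s\<ge>0. \<forall>t\<ge>s. distr M borel (\<lambda>\<omega>. S t \<omega> - S s \<omega>) = distr M borel (S (t - s))) \<and>
     (\<forall>t\<ge>0. \<forall>u>0. (\<integral>\<omega>. exp (- u * S t \<omega>) \<partial>M) = exp (- t * \<Psi> u))"

text \<open>Brownian motion started at the origin and running twice as fast as the standard one: the
  coordinates of \<open>B\<^sub>t - B\<^sub>s\<close> are independent with variance \<open>2 (t - s)\<close>.\<close>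

definition double_speed_brownian :: "'w measure \<Rightarrow> (real \<Rightarrow> 'w \<Rightarrow> real ^ 'n) \<Rightarrow> bool" where
  "double_speed_brownian M B \<longleftrightarrow>
     (\<forall>t\<ge>0. B t \<in> borel_measurable M) \<and>
     (AE \<omega> in M. B 0 \<omega> = 0 \<and> continuous_on {0..} (\<lambda>t. B t \<omega>)) \<and>
     indep_increments M B \<and>
     (\<forall>s\<ge>0. \<forall>t>s. distributed M lborel (\<lambda>\<omega>. B t \<omega> - B s \<omega>)
        (\<lambda>x. ennreal (\<Prod>i\<in>UNIV. normal_density 0 (sqrt (2 * (t - s))) (x $ i))))"

text \<open>Independence of the \<open>\<sigma>\<close>-algebras generated by the two processes. (The library's
  \<open>indep_var\<close> needs random elements of the same type.)\<close>

definition indep_processes ::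
    "'w measure \<Rightarrow> (real \<Rightarrow> 'w \<Rightarrow> 'a::euclidean_space) \<Rightarrow> (real \<Rightarrow> 'w \<Rightarrow> 'b::euclidean_space) \<Rightarrow> bool" where
  "indep_processes M S B \<longleftrightarrow>
     prob_space.indep_set M
       (sets (vimage_algebra (space M) (\<lambda>\<omega>. \<lambda>t\<in>{0..}. S t \<omega>) (\<Pi>\<^sub>M t\<in>{0..}. borel)))
       (sets (vimage_algebra (space M) (\<lambda>\<omega>. \<lambda>t\<in>{0..}. B t \<omega>) (\<Pi>\<^sub>M t\<in>{0..}. borel)))"

definition subordinated :: "(real \<Rightarrow> 'w \<Rightarrow> 'a) \<Rightarrow> (real \<Rightarrow> 'w \<Rightarrow> real) \<Rightarrow> real \<Rightarrow> 'w \<Rightarrow> 'a" where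
  "subordinated B S t \<omega> = B (S t \<omega>) \<omega>"


section \<open>The killed Feynman-Kac semigroup and its eigenfunctions\<close>

definition exit_time :: "'a set \<Rightarrow> (real \<Rightarrow> 'a) \<Rightarrow> ereal" where
  "exit_time D p = Inf (ereal ` {t. 0 < t \<and> p t \<notin> D})"

text \<open>Here \<open>X\<close> starts at the origin, and \<open>\<bbbE>\<^sup>x\<close> is the expectation for the process \<open>x + X\<close>. It is
  taken over the completion of \<open>M\<close>, since the path properties of \<open>X\<close> hold only almost surely and
  the exit time of a right-continuous process is in general only measurable up to null sets.\<close>

definition killed_feynman_kac ::
    "'w measure \<Rightarrow> (real \<Rightarrow> 'w \<Rightarrow> real ^ 'n) \<Rightarrow> (real ^ 'n) set \<Rightarrow> (real ^ 'n \<Rightarrow> real) \<Rightarrow>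
     real \<Rightarrow> (real ^ 'n \<Rightarrow> real) \<Rightarrow> real ^ 'n \<Rightarrow> real" where
  "killed_feynman_kac M X D V t f x =
     (\<integral>\<omega>. exp (- (LINT s:{0..t}|lborel. V (x + X s \<omega>))) * f (x + X t \<omega>) *
           indicator {\<omega>. exit_time D (\<lambda>s. x + X s \<omega>) > ereal t} \<omega> \<partial>completion M)"

text \<open>Non-zero solutions of \<open>(\<Psi>(-\<Delta>) + V) \<phi> = lam \<phi>\<close> in \<open>D\<close>, \<open>\<phi> = 0\<close> off \<open>D\<close>, expressed by the
  semigroup that the Friedrichs extension of \<open>\<Psi>(-\<Delta>) + V\<close> generates. Non-zero is meant in
  \<open>L\<^sup>2(D)\<close>, and \<open>\<phi>\<close> is the version for which the eigenvalue equation holds at every point.\<close>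

definition dirichlet_eigenfunction ::
    "'w measure \<Rightarrow> (real \<Rightarrow> 'w \<Rightarrow> real ^ 'n) \<Rightarrow> (real ^ 'n) set \<Rightarrow> (real ^ 'n \<Rightarrow> real) \<Rightarrow>
     real \<Rightarrow> (real ^ 'n \<Rightarrow> real) \<Rightarrow> bool" where
  "dirichlet_eigenfunction M X D V lam \<phi> \<longleftrightarrow>
     \<phi> \<in> borel_measurable borel \<and>
     set_integrable lborel D (\<lambda>x. (\<phi> x)\<^sup>2) \<and>
     (\<forall>x. x \<notin> D \<longrightarrow> \<phi> x = 0) \<and>
     \<not> (AE x in lborel. x \<in> D \<longrightarrow> \<phi> x = 0) \<and>
     (\<forall>t>0. \<forall>x\<in>D. killed_feynman_kac M X D V t \<phi> x = exp (- lam * t) * \<phi> x)"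


section \<open>Essential bounds\<close>

text \<open>\<open>L\<^sup>\<infinity>(\<real>\<^sup>d)\<close>, by Borel representatives.\<close>

definition in_Linfty :: "(real ^ 'n \<Rightarrow> real) \<Rightarrow> bool" where
  "in_Linfty V \<longleftrightarrow> V \<in> borel_measurable borel \<and> (\<exists>C. AE x in lborel. \<bar>V x\<bar> \<le> C)"

definition Linfty_norm :: "(real ^ 'n \<Rightarrow> real) \<Rightarrow> real" where
  "Linfty_norm f = real_of_ereal (esssup lborel (\<lambda>x. ereal \<bar>f x\<bar>))"

definition ess_inf_on :: "(real ^ 'n) set \<Rightarrow> (real ^ 'n \<Rightarrow> real) \<Rightarrow> real" where
  "ess_inf_on D f = real_of_ereal (- esssup (restrict_space lborel D) (\<lambda>x. - ereal (f x)))"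


section \<open>The constant \<open>\<theta>\<close>\<close>

definition gauss2_cdf :: "real \<Rightarrow> real" where
  "gauss2_cdf = cdf (density lborel (\<lambda>x. ennreal (normal_density 0 (sqrt 2) x)))"

definition theta_fun :: "real \<Rightarrow> real" where
  "theta_fun \<kappa> = (1 / \<kappa>) * ln (1 - gauss2_cdf (-1) * (1 - exp (1 - \<kappa>)))"

text \<open>The infimum below is a minimum, see \<open>theta_attained\<close>.\<close>

definition theta :: real where
  "theta = - (INF \<kappa>\<in>{1<..}. theta_fun \<kappa>)"

lemma gauss2_cdf_bounds: "0 < gauss2_cdf (-1)" "gauss2_cdf (-1) < 1"
proof -
  let ?N = "density lborel (\<lambda>x. ennreal (normal_density 0 (sqrt 2) x))"
  interpret N: prob_space ?N
    by (rule prob_space_normal_density) simp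
  have pos: "0 < measure ?N A" if A: "A \<in> sets borel" "emeasure lborel A \<noteq> 0" for A :: "real set"
  proof (rule ccontr)
    assume "\<not> 0 < measure ?N A"
    then have "A \<in> null_sets ?N"
      using A(1) by (simp add: null_sets_def N.emeasure_eq_measure not_less measure_le_0_iff)
    then have "AE x in lborel. x \<notin> A"
      using A(1) normal_density_pos[of "sqrt 2" 0]
      by (auto simp: null_sets_density_iff ennreal_eq_0_iff not_le[symmetric] elim!: eventually_mono)
    then have "A \<in> null_sets lborel"
      using A(1) by (simp add: AE_iff_null_sets)
    with A(2) show False by auto
  qed
  show "0 < gauss2_cdf (-1)"
    unfolding gauss2_cdf_def cdf_def
  proof (rule pos)
    have "emeasure lborel {-2..-1::real} \<le> emeasure lborel {..-1::real}"
      by (rule emeasure_mono) auto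
    then show "emeasure lborel {..-1::real} \<noteq> 0" by (auto simp: emeasure_lborel_Icc_eq)
  qed simp
  have "0 < measure ?N {-1<..}"
  proof (rule pos)
    have "emeasure lborel {0..1::real} \<le> emeasure lborel {-1::real<..}"
      by (rule emeasure_mono) auto
    then show "emeasure lborel {-1::real<..} \<noteq> 0" by (auto simp: emeasure_lborel_Icc_eq)
  qed simp
  moreover have "measure ?N {-1<..} = 1 - measure ?N {..-1}"
    using N.prob_compl[of "{..-1}"] by (simp add: Compl_eq_Diff_UNIV[symmetric] Compl_atMost)
  ultimately show "gauss2_cdf (-1) < 1"
    by (simp add: gauss2_cdf_def cdf_def)
qed

lemma theta_attained:
  obtains \<kappa> where "1 < \<kappa>" "theta = - theta_fun \<kappa>" "\<And>\<kappa>'. 1 < \<kappa>' \<Longrightarrow> theta_fun \<kappa> \<le> theta_fun \<kappa>'"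
proof -
  let ?p = "gauss2_cdf (-1)"
  note p = gauss2_cdf_bounds
  have arg: "1 - ?p \<le> 1 - ?p * (1 - exp (1 - \<kappa>))" if "1 \<le> \<kappa>" for \<kappa> :: real
    using p by (simp add: mult_left_le)
  have argpos: "0 < 1 - ?p * (1 - exp (1 - \<kappa>))" if "1 \<le> \<kappa>" for \<kappa> :: real
    using arg[OF that] p by linarith
  have low: "ln (1 - ?p) / \<kappa> \<le> theta_fun \<kappa>" if "1 \<le> \<kappa>" for \<kappa>
    using arg[OF that] argpos[OF that] p that
    by (simp add: theta_fun_def divide_right_mono)
  have neg2: "theta_fun 2 < 0"
  proof -
    have "0 < ?p * (1 - exp (1 - 2))" using p by simp
    then show ?thesis using argpos[of 2] by (simp add: theta_fun_def)
  qed
  have one: "theta_fun 1 = 0" by (simp add: theta_fun_def)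
  define K where "K = max 2 (ln (1 - ?p) / theta_fun 2)"
  have K: "2 \<le> K" by (simp add: K_def)
  have "continuous_on {1..K} theta_fun"
    unfolding theta_fun_def using argpos by (intro continuous_intros) (auto simp: less_le)
  then obtain k where k: "k \<in> {1..K}" "\<And>y. y \<in> {1..K} \<Longrightarrow> theta_fun k \<le> theta_fun y"
    using continuous_attains_inf[of "{1..K}" theta_fun] K by auto
  have k2: "theta_fun k \<le> theta_fun 2" using k(2)[of 2] K by simp
  have k1: "1 < k" using k(1) k2 neg2 one by (cases "k = 1") auto
  have min: "theta_fun k \<le> theta_fun y" if "1 < y" for y
  proof (cases "y \<le> K")
    case True then show ?thesis using k(2) that by simp
  next
    case False
    then have "ln (1 - ?p) / theta_fun 2 \<le> y" by (simp add: K_def)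
    then have "y * theta_fun 2 \<le> ln (1 - ?p)" using neg2 by (simp add: neg_divide_le_eq)
    then have "theta_fun 2 \<le> ln (1 - ?p) / y" using that by (simp add: pos_le_divide_eq mult.commute)
    also have "\<dots> \<le> theta_fun y" using low that by simp
    finally show ?thesis using k2 by simp
  qed
  have "(INF \<kappa>\<in>{1<..}. theta_fun \<kappa>) = theta_fun k"
    using k1 min by (intro cInf_eq_minimum) auto
  then show ?thesis using that[of k] k1 min by (simp add: theta_def)
qed

end

theory Submission
  imports Defs
begin

text \<open>Take a point \<open>x \<in> D\<close> at which \<open>\<bar>\<phi>\<bar>\<close> nearly attains its essential supremum. If \<open>u\<close> is so small
  that \<open>\<bar>D\<bar> u\<^sup>d\<^sup>/\<^sup>2 < \<omega>\<^sub>d\<close>, the ball of radius \<open>u\<^sup>-\<^sup>1\<^sup>/\<^sup>2\<close> about \<open>x\<close> is not contained in \<open>D\<close>, so by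
  convexity \<open>D\<close> lies in a half-space whose boundary is closer to \<open>x\<close> than \<open>u\<^sup>-\<^sup>1\<^sup>/\<^sup>2\<close>. The process has
  left this half-space at time \<open>t\<close> as soon as \<open>S\<^sub>t \<ge> 1/u\<close> and the component of the Brownian motion
  normal to its boundary exceeds \<open>\<surd>S\<^sub>t\<close>; the second event has conditional probability \<open>F(-1)\<close>, the
  first has probability at least \<open>1 - exp (1 - t \<Psi>(u))\<close> by Markov's inequality. Inserting this at
  \<open>t = \<kappa> / \<Psi>(u)\<close> in the Feynman-Kac representation of \<open>\<phi>(x)\<close>, with the minimising \<open>\<kappa>\<close> in the
  definition of \<open>\<theta>\<close>, gives \<open>\<theta> \<Psi>(u) \<le> \<parallel>V\<^sup>-\<parallel> - inf V\<^sup>+ + \<lambda>\<close>.\<close>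

section \<open>Gaussian vectors\<close>

text \<open>Fubini for product integrands, reindexed from the set \<open>Basis\<close> to the
  coordinate type by \<open>i \<mapsto> axis i 1\<close>.\<close>

lemma nn_integral_lborel_prod_vec:
  fixes f :: "'n::finite \<Rightarrow> real \<Rightarrow> ennreal"
  assumes [measurable]: "\<And>i. f i \<in> borel_measurable borel"
  shows "(\<integral>\<^sup>+x. (\<Prod>i\<in>UNIV. f i (x $ i)) \<partial>lborel) = (\<Prod>i\<in>UNIV. \<integral>\<^sup>+x. f i x \<partial>lborel)"
proof -
  define e where "e i = (axis i 1 :: real ^ 'n)" for i
  have inj: "inj e" by (auto simp: inj_def e_def axis_eq_axis)
  have basis: "Basis = range e" by (auto simp: Basis_vec_def e_def)
  have "(\<integral>\<^sup>+x. (\<Prod>b\<in>Basis. f (inv e b) (x \<bullet> b)) \<partial>lborel)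
      = (\<Prod>b\<in>Basis. \<integral>\<^sup>+x. f (inv e b) x \<partial>lborel)"
    by (rule nn_integral_lborel_prod) auto
  then show ?thesis
    by (simp add: basis prod.reindex[OF inj] inv_f_f[OF inj]) (simp add: e_def inner_axis)
qed

context prob_space
begin

lemma distributed_vec_rectangle:
  fixes X :: "'a \<Rightarrow> real ^ 'n" and f :: "'n \<Rightarrow> real \<Rightarrow> real"
  assumes [measurable]: "\<And>i. f i \<in> borel_measurable borel" and nonneg: "\<And>i x. 0 \<le> f i x"
    and X: "distributed M lborel X (\<lambda>x. ennreal (\<Prod>i\<in>UNIV. f i (x $ i)))"
    and A[measurable]: "\<And>i. A i \<in> sets borel"
  shows "emeasure M {\<omega>\<in>space M. \<forall>i. X \<omega> $ i \<in> A i} =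
    (\<Prod>i\<in>UNIV. \<integral>\<^sup>+x. ennreal (f i x) * indicator (A i) x \<partial>lborel)"
proof -
  have [measurable]: "{y. \<forall>i. y $ i \<in> A i} \<in> sets (lborel :: (real ^ 'n) measure)"
  proof -
    have "{y \<in> space (lborel :: (real ^ 'n) measure). \<forall>i. y $ i \<in> A i} \<in> sets lborel"
      by measurable
    then show ?thesis by simp
  qed
  have "emeasure M {\<omega>\<in>space M. \<forall>i. X \<omega> $ i \<in> A i} = emeasure M (X -` {y. \<forall>i. y $ i \<in> A i} \<inter> space M)"
    by (rule arg_cong[where f = "emeasure M"]) auto
  also have "\<dots> = (\<integral>\<^sup>+y. ennreal (\<Prod>i\<in>UNIV. f i (y $ i)) * indicator {y. \<forall>i. y $ i \<in> A i} y \<partial>lborel)"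
    by (rule distributed_emeasure[OF X]) auto
  also have "\<dots> = (\<integral>\<^sup>+y. (\<Prod>i\<in>UNIV. ennreal (f i (y $ i)) * indicator (A i) (y $ i)) \<partial>lborel)"
  proof (rule nn_integral_cong)
    fix y :: "real ^ 'n"
    have "indicator {y. \<forall>i. y $ i \<in> A i} y = (\<Prod>i\<in>UNIV. indicator (A i) (y $ i) :: ennreal)"
      by (auto simp: indicator_def prod_zero_iff)
    then show "ennreal (\<Prod>i\<in>UNIV. f i (y $ i)) * indicator {y. \<forall>i. y $ i \<in> A i} y =
        (\<Prod>i\<in>UNIV. ennreal (f i (y $ i)) * indicator (A i) (y $ i))"
      using nonneg by (simp add: prod.distrib prod_ennreal)
  qed
  also have "\<dots> = (\<Prod>i\<in>UNIV. \<integral>\<^sup>+x. ennreal (f i x) * indicator (A i) x \<partial>lborel)"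
    by (rule nn_integral_lborel_prod_vec) measurable
  finally show ?thesis .
qed

text \<open>Both claims are read off from the probabilities of rectangles. A rectangle with all
  sides but one equal to \<open>UNIV\<close> gives the marginal law, since the other factors
  integrate to 1; a general rectangle then gives the product formula, which is enough for
  independence because the Borel sets are closed under intersection.\<close>

lemma
  fixes X :: "'a \<Rightarrow> real ^ 'n" and f :: "'n \<Rightarrow> real \<Rightarrow> real"
  assumes f[measurable]: "\<And>i. f i \<in> borel_measurable borel" and nonneg: "\<And>i x. 0 \<le> f i x"
    and total: "\<And>i. (\<integral>\<^sup>+x. ennreal (f i x) \<partial>lborel) = 1"
    and X: "distributed M lborel X (\<lambda>x. ennreal (\<Prod>i\<in>UNIV. f i (x $ i)))"
  shows distributed_vec_nth: "distributed M lborel (\<lambda>\<omega>. X \<omega> $ i) (\<lambda>x. ennreal (f i x))"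
    and indep_vars_vec_nth: "indep_vars (\<lambda>_. borel) (\<lambda>i \<omega>. X \<omega> $ i) UNIV"
proof -
  note rect = distributed_vec_rectangle[OF f nonneg X]
  have [measurable]: "X \<in> borel_measurable M"
    using distributed_measurable[OF X] by simp
  have [measurable]: "(\<lambda>\<omega>. X \<omega> $ i) \<in> borel_measurable M" for i
    by (rule measurable_compose[OF \<open>X \<in> borel_measurable M\<close>])
      (simp add: borel_measurable_continuous_onI continuous_on_component)
  have single: "emeasure M {\<omega>\<in>space M. X \<omega> $ i \<in> A} = (\<integral>\<^sup>+x. ennreal (f i x) * indicator A x \<partial>lborel)"
    if [measurable]: "A \<in> sets borel" for i A
  proof -
    have "emeasure M {\<omega>\<in>space M. X \<omega> $ i \<in> A} =
        emeasure M {\<omega>\<in>space M. \<forall>j. X \<omega> $ j \<in> (if j = i then A else UNIV)}"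
      by (rule arg_cong[where f = "emeasure M"]) (auto split: if_splits)
    also have "\<dots> = (\<Prod>j\<in>UNIV. \<integral>\<^sup>+x. ennreal (f j x) * indicator (if j = i then A else UNIV) x \<partial>lborel)"
      by (rule rect) auto
    also have "\<dots> = (\<Prod>j\<in>UNIV. if j = i then \<integral>\<^sup>+x. ennreal (f i x) * indicator A x \<partial>lborel else 1)"
      by (rule prod.cong) (auto simp: total)
    finally show ?thesis by simp
  qed
  show "distributed M lborel (\<lambda>\<omega>. X \<omega> $ i) (\<lambda>x. ennreal (f i x))" for i
  proof -
    have "distr M lborel (\<lambda>\<omega>. X \<omega> $ i) = density lborel (\<lambda>x. ennreal (f i x))"
    proof (rule measure_eqI)
      fix A assume "A \<in> sets (distr M lborel (\<lambda>\<omega>. X \<omega> $ i))"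
      then have [measurable]: "A \<in> sets borel" by simp
      have "emeasure (distr M lborel (\<lambda>\<omega>. X \<omega> $ i)) A = emeasure M {\<omega>\<in>space M. X \<omega> $ i \<in> A}"
        by (subst emeasure_distr) (auto intro!: arg_cong[where f = "emeasure M"])
      then show "emeasure (distr M lborel (\<lambda>\<omega>. X \<omega> $ i)) A = emeasure (density lborel (\<lambda>x. ennreal (f i x))) A"
        by (simp add: single emeasure_density)
    qed simp
    then show ?thesis by (simp add: distributed_def)
  qed
  show "indep_vars (\<lambda>_. borel) (\<lambda>i \<omega>. X \<omega> $ i) UNIV"
  proof (subst indep_vars_finite[where E = "\<lambda>_. sets borel"])
    show "\<forall>A\<in>UNIV \<rightarrow> sets borel. prob (\<Inter>j\<in>UNIV. (\<lambda>\<omega>. X \<omega> $ j) -` A j \<inter> space M) =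
        (\<Prod>j\<in>UNIV. prob ((\<lambda>\<omega>. X \<omega> $ j) -` A j \<inter> space M))"
    proof
      fix A :: "'n \<Rightarrow> real set" assume "A \<in> UNIV \<rightarrow> sets borel"
      then have A[measurable]: "A i \<in> sets borel" for i by auto
      have "ennreal (prob (\<Inter>j\<in>UNIV. (\<lambda>\<omega>. X \<omega> $ j) -` A j \<inter> space M)) =
          emeasure M {\<omega>\<in>space M. \<forall>j. X \<omega> $ j \<in> A j}"
        unfolding emeasure_eq_measure[symmetric] by (rule arg_cong[where f = "emeasure M"]) auto
      also have "\<dots> = (\<Prod>j\<in>UNIV. emeasure M {\<omega>\<in>space M. X \<omega> $ j \<in> A j})"
        by (simp add: rect single)
      also have "\<dots> = (\<Prod>j\<in>UNIV. ennreal (prob ((\<lambda>\<omega>. X \<omega> $ j) -` A j \<inter> space M)))"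
        unfolding emeasure_eq_measure[symmetric]
        by (intro prod.cong refl arg_cong[where f = "emeasure M"]) auto
      finally show "prob (\<Inter>j\<in>UNIV. (\<lambda>\<omega>. X \<omega> $ j) -` A j \<inter> space M) =
        (\<Prod>j\<in>UNIV. prob ((\<lambda>\<omega>. X \<omega> $ j) -` A j \<inter> space M))"
        by (simp add: prod_ennreal prod_nonneg)
    qed
  qed (auto simp: sets.sigma_sets_eq[of borel, simplified] Int_stable_def)
qed

lemma distributed_normal_inner:
  fixes X :: "'a \<Rightarrow> real ^ 'n" and w :: "real ^ 'n"
  assumes X: "distributed M lborel X (\<lambda>x. ennreal (\<Prod>i\<in>UNIV. normal_density 0 \<sigma> (x $ i)))"
    and \<sigma>: "0 < \<sigma>" and w: "w \<noteq> 0"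
  shows "distributed M lborel (\<lambda>\<omega>. w \<bullet> X \<omega>) (\<lambda>x. ennreal (normal_density 0 (norm w * \<sigma>) x))"
proof -
  \<comment> \<open>A coordinate with \<open>w $ i = 0\<close> contributes the constant 0, which has
    no normal density, so the sum of independent normals runs over the remaining coordinates
    only.\<close>
  define I where "I = {i. w $ i \<noteq> 0}"
  have I: "finite I" "I \<noteq> {}" using w by (auto simp: I_def vec_eq_iff)
  have total: "(\<integral>\<^sup>+x. ennreal (normal_density 0 \<sigma> x) \<partial>lborel) = 1"
    using prob_space.emeasure_space_1[OF prob_space_normal_density[OF \<sigma>, of 0]]
    by (simp add: emeasure_density)
  note coord = distributed_vec_nth[OF _ _ total X] and indep = indep_vars_vec_nth[OF _ _ total X]
  have "indep_vars (\<lambda>_. borel) (\<lambda>i \<omega>. X \<omega> $ i) I"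
    by (rule indep_vars_subset[OF indep]) auto
  then have ind: "indep_vars (\<lambda>_. borel) (\<lambda>i \<omega>. w $ i * X \<omega> $ i) I"
    by (rule indep_vars_compose2[where Y = "\<lambda>i x. w $ i * x"]) auto
  have "distributed M lborel (\<lambda>\<omega>. w $ i * X \<omega> $ i) (normal_density 0 (\<bar>w $ i\<bar> * \<sigma>))" if "i \<in> I" for i
    using normal_density_affine[OF coord, of "w $ i" 0 i] that \<sigma> by (simp add: I_def)
  from sum_indep_normal[OF I ind _ this] \<sigma>
  have "distributed M lborel (\<lambda>\<omega>. \<Sum>i\<in>I. w $ i * X \<omega> $ i)
      (normal_density 0 (sqrt (\<Sum>i\<in>I. (\<bar>w $ i\<bar> * \<sigma>)\<^sup>2)))"
    by (simp add: I_def)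
  moreover have "(\<Sum>i\<in>I. w $ i * X \<omega> $ i) = w \<bullet> X \<omega>" for \<omega>
    unfolding inner_vec_def by (rule sum.mono_neutral_cong_left) (auto simp: I_def)
  moreover have "(\<Sum>i\<in>I. (\<bar>w $ i\<bar> * \<sigma>)\<^sup>2) = (norm w * \<sigma>)\<^sup>2"
  proof -
    have "(\<Sum>i\<in>I. (\<bar>w $ i\<bar> * \<sigma>)\<^sup>2) = (\<Sum>i\<in>UNIV. (w $ i)\<^sup>2 * \<sigma>\<^sup>2)"
      by (rule sum.mono_neutral_cong_left) (auto simp: I_def power_mult_distrib)
    also have "\<dots> = (norm w * \<sigma>)\<^sup>2"
      unfolding power_mult_distrib power2_norm_eq_inner
      by (simp add: inner_vec_def power2_eq_square sum_distrib_right)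
    finally show ?thesis .
  qed
  ultimately show ?thesis using \<sigma> by simp
qed

end


section \<open>Evaluation of right-continuous paths\<close>

text \<open>For \<open>s \<ge> 0\<close> this is the least multiple of \<open>1 / Suc n\<close>
  strictly above \<open>s\<close>. Strictness makes the approach to \<open>s\<close> one-sided, and
  for fixed \<open>n\<close> only countably many values occur. For negative \<open>s\<close> the
  truncation by \<open>nat\<close> keeps the value positive, hence inside the index set
  \<open>{0..}\<close>.\<close>

definition grid :: "nat \<Rightarrow> real \<Rightarrow> real" where
  "grid n s = (real (nat \<lfloor>s * real (Suc n)\<rfloor>) + 1) / real (Suc n)"

lemma grid_pos: "0 < grid n s"
  by (simp add: grid_def add_pos_nonneg)

lemma grid_bounds:
  assumes "0 \<le> s"
  shows "s < grid n s" "grid n s \<le> s + 1 / real (Suc n)"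
proof -
  have "0 \<le> s * real (Suc n)" using assms by simp
  then have "real (nat \<lfloor>s * real (Suc n)\<rfloor>) = of_int \<lfloor>s * real (Suc n)\<rfloor>"
    by (subst of_nat_nat) auto
  then show "s < grid n s" "grid n s \<le> s + 1 / real (Suc n)"
    using floor_correct[of "s * real (Suc n)"] unfolding grid_def
    by (simp_all only: pos_less_divide_eq pos_divide_le_eq of_nat_0_less_iff zero_less_Suc ring_distribs) auto
qed

lemma filterlim_grid:
  assumes "0 \<le> s"
  shows "filterlim (\<lambda>n. grid n s) (at_right s) sequentially"
proof (rule tendsto_imp_filterlim_at_right)
  have "(\<lambda>n. s + 1 / real (Suc n)) \<longlonglongrightarrow> s + 0"
    by (intro tendsto_intros) (use LIMSEQ_inverse_real_of_nat in \<open>simp add: inverse_eq_divide\<close>)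
  then show "(\<lambda>n. grid n s) \<longlonglongrightarrow> s"
    by (intro tendsto_sandwich[of "\<lambda>_. s" "\<lambda>n. grid n s" _ "\<lambda>n. s + 1 / real (Suc n)"]
        always_eventually allI less_imp_le[OF grid_bounds(1)] grid_bounds(2) assms) simp_all
qed (auto intro: always_eventually grid_bounds assms)

text \<open>For a right-continuous path this is evaluation at \<open>s\<close>, but it is jointly measurable in the
  time and the path, with respect to the product \<open>\<sigma>\<close>-algebra on paths.\<close>

definition right_eval :: "(real \<Rightarrow> 'a::t2_space) \<Rightarrow> real \<Rightarrow> 'a" where
  "right_eval p s = lim (\<lambda>n. p (grid n s))"

lemma right_eval_eq:
  fixes p :: "real \<Rightarrow> 'a::t2_space"
  assumes "continuous (at_right s) p" "0 \<le> s"
  shows "right_eval (restrict p {0..}) s = p s"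
proof -
  have "(\<lambda>n. p (grid n s)) \<longlonglongrightarrow> p s"
    using assms filterlim_compose[OF _ filterlim_grid] by (auto simp: continuous_within)
  then show ?thesis
    unfolding right_eval_def using grid_pos[THEN less_imp_le] by (intro limI) simp
qed

text \<open>For fixed \<open>n\<close> the time \<open>grid n s\<close> takes countably many values,
  and on each of the corresponding sets of times the map is a coordinate projection. The limit over
  \<open>n\<close> preserves measurability.\<close>

lemma borel_measurable_right_eval:
  "(\<lambda>x. right_eval (snd x) (fst x)) \<in> borel_measurable
    (borel \<Otimes>\<^sub>M (\<Pi>\<^sub>M t\<in>{0..}. (borel :: 'a::{banach, second_countable_topology} measure)))"
proof -
  have [measurable]: "(\<lambda>x. snd x (grid n (fst x))) \<in> borel_measurable
      (borel \<Otimes>\<^sub>M (\<Pi>\<^sub>M t\<in>{0..}. (borel :: 'a measure)))" for n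
    unfolding grid_def
  proof (rule measurable_compose_countable[where f = "\<lambda>k x. snd x ((real k + 1) / real (Suc n))"])
    show "(\<lambda>x. snd x ((real k + 1) / real (Suc n))) \<in> borel_measurable
      (borel \<Otimes>\<^sub>M (\<Pi>\<^sub>M t\<in>{0..}. (borel :: 'a measure)))" for k
      by (rule measurable_compose[OF measurable_snd measurable_component_singleton]) auto
  qed measurable
  show ?thesis
    unfolding right_eval_def by measurable
qed


section \<open>The law of subordinate Brownian motion\<close>

locale subordinate_brownian = prob_space M
  for M :: "'w measure" +
  fixes \<Psi> :: "real \<Rightarrow> real" and S :: "real \<Rightarrow> 'w \<Rightarrow> real" and B :: "real \<Rightarrow> 'w \<Rightarrow> real ^ 'n"
  assumes subordinator: "subordinator M \<Psi> S"
    and brownian: "double_speed_brownian M B"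
    and independent: "indep_processes M S B"
begin

text \<open>The path as a point of the product space over \<open>{0..}\<close>, the form in which
  \<open>indep_processes\<close> speaks of it.\<close>

definition S_path :: "'w \<Rightarrow> real \<Rightarrow> real" where "S_path \<omega> = (\<lambda>t\<in>{0..}. S t \<omega>)"
definition B_path :: "'w \<Rightarrow> real \<Rightarrow> real ^ 'n" where "B_path \<omega> = (\<lambda>t\<in>{0..}. B t \<omega>)"

text \<open>A version of the subordinate process that is jointly measurable in time and outcome and
  depends only on the two independent paths. Outside one null set it agrees with
  \<open>subordinated B S\<close> at all times simultaneously.\<close>

definition X_mod :: "real \<Rightarrow> 'w \<Rightarrow> real ^ 'n" where
  "X_mod s \<omega> = right_eval (B_path \<omega>) (right_eval (S_path \<omega>) s)"

lemma measurable_S: "0 \<le> t \<Longrightarrow> S t \<in> borel_measurable M"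
  using subordinator by (simp add: subordinator_def)

lemma measurable_B: "0 \<le> t \<Longrightarrow> B t \<in> borel_measurable M"
  using brownian by (simp add: double_speed_brownian_def)

lemma measurable_S_path [measurable]: "S_path \<in> M \<rightarrow>\<^sub>M (\<Pi>\<^sub>M t\<in>{0..}. borel)"
  unfolding S_path_def by (rule measurable_restrict) (simp add: measurable_S)

lemma measurable_B_path [measurable]: "B_path \<in> M \<rightarrow>\<^sub>M (\<Pi>\<^sub>M t\<in>{0..}. borel)"
  unfolding B_path_def by (rule measurable_restrict) (simp add: measurable_B)

lemma AE_S_path:
  "AE \<omega> in M. S 0 \<omega> = 0 \<and> (\<forall>s\<ge>0. 0 \<le> S s \<omega> \<and> right_eval (S_path \<omega>) s = S s \<omega>)"
proof -
  have "AE \<omega> in M. S 0 \<omega> = 0 \<and> mono_on {0..} (\<lambda>t. S t \<omega>) \<and>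
        (\<forall>t\<ge>0. continuous (at_right t) (\<lambda>t. S t \<omega>))"
    using subordinator by (simp add: subordinator_def)
  then show ?thesis
  proof (eventually_elim)
    case (elim \<omega>)
    then have "0 \<le> S s \<omega>" if "0 \<le> s" for s
      using mono_onD[of "{0..}" "\<lambda>t. S t \<omega>" 0 s] that by auto
    with elim show ?case by (auto simp: S_path_def right_eval_eq)
  qed
qed

lemma AE_B_path:
  "AE \<omega> in M. B 0 \<omega> = 0 \<and> (\<forall>s\<ge>0. right_eval (B_path \<omega>) s = B s \<omega>)"
proof -
  have "AE \<omega> in M. B 0 \<omega> = 0 \<and> continuous_on {0..} (\<lambda>t. B t \<omega>)"
    using brownian by (simp add: double_speed_brownian_def)
  then show ?thesis
  proof (eventually_elim)
    case (elim \<omega>)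
    have "continuous (at_right s) (\<lambda>t. B t \<omega>)" if "0 \<le> s" for s
      using elim that unfolding continuous_on_eq_continuous_within
      by (auto intro: continuous_within_subset)
    with elim show ?case by (auto simp: B_path_def right_eval_eq)
  qed
qed

lemma AE_X_mod: "AE \<omega> in M. \<forall>s\<ge>0. X_mod s \<omega> = subordinated B S s \<omega>"
  using AE_S_path AE_B_path by eventually_elim (simp add: X_mod_def subordinated_def)

lemma measurable_X_mod: "(\<lambda>x. X_mod (fst x) (snd x)) \<in> borel_measurable (borel \<Otimes>\<^sub>M M)"
proof -
  have "(\<lambda>x. (fst x, S_path (snd x))) \<in> borel \<Otimes>\<^sub>M M \<rightarrow>\<^sub>M borel \<Otimes>\<^sub>M (\<Pi>\<^sub>M t\<in>{0..}. borel)"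
    by measurable
  from measurable_compose[OF this borel_measurable_right_eval]
  have [measurable]: "(\<lambda>x. right_eval (S_path (snd x)) (fst x)) \<in> borel_measurable (borel \<Otimes>\<^sub>M M)"
    by simp
  have "(\<lambda>x. (right_eval (S_path (snd x)) (fst x), B_path (snd x))) \<in>
      borel \<Otimes>\<^sub>M M \<rightarrow>\<^sub>M borel \<Otimes>\<^sub>M (\<Pi>\<^sub>M t\<in>{0..}. borel)"
    by measurable
  from measurable_compose[OF this borel_measurable_right_eval]
  show ?thesis by (simp add: X_mod_def)
qed

lemma measurable_X_mod' [measurable]: "X_mod s \<in> borel_measurable M"
  using measurable_compose[OF measurable_Pair1' measurable_X_mod, of s] by simp

lemma indep_S_B_path:
  assumes s: "0 \<le> s" and A: "A \<in> sets borel" and C: "C \<in> sets (\<Pi>\<^sub>M t\<in>{0..}. borel)"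
  shows "emeasure M {\<omega>\<in>space M. S s \<omega> \<in> A \<and> B_path \<omega> \<in> C} =
    emeasure M {\<omega>\<in>space M. S s \<omega> \<in> A} * emeasure M {\<omega>\<in>space M. B_path \<omega> \<in> C}"
proof -
  let ?P = "\<Pi>\<^sub>M t\<in>{0..}. (borel :: real measure)"
  let ?E = "{\<omega>\<in>space M. S s \<omega> \<in> A}" and ?F = "{\<omega>\<in>space M. B_path \<omega> \<in> C}"
  have "{p\<in>space ?P. p s \<in> A} \<in> sets ?P"
    using measurable_sets[OF measurable_component_singleton[of s "{0..}" "\<lambda>_. borel :: real measure"] A] s
    by (simp add: vimage_def Int_def conj_commute)
  moreover have "?E = S_path -` {p\<in>space ?P. p s \<in> A} \<inter> space M"
    using measurable_space[OF measurable_S_path] s by (auto simp: S_path_def)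
  ultimately have E: "?E \<in> sets (vimage_algebra (space M) S_path ?P)"
    by (simp only:) (rule in_vimage_algebra)
  have F: "?F \<in> sets (vimage_algebra (space M) B_path (\<Pi>\<^sub>M t\<in>{0..}. borel))"
    using in_vimage_algebra[OF C, of B_path "space M"] by (simp add: vimage_def Int_def conj_commute)
  have "indep_set (sets (vimage_algebra (space M) S_path ?P))
      (sets (vimage_algebra (space M) B_path (\<Pi>\<^sub>M t\<in>{0..}. borel)))"
    using independent by (simp add: indep_processes_def S_path_def[abs_def] B_path_def[abs_def])
  from indep_setD[OF this E F] show ?thesis
    by (simp add: emeasure_eq_measure ennreal_mult'' Int_def conj_ac cong: conj_cong)
qed

lemma joint_law_S_B_path:
  assumes s: "0 \<le> s"
  shows "distr M borel (S s) \<Otimes>\<^sub>M distr M (\<Pi>\<^sub>M t\<in>{0..}. borel) B_path =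
    distr M (borel \<Otimes>\<^sub>M (\<Pi>\<^sub>M t\<in>{0..}. borel)) (\<lambda>\<omega>. (S s \<omega>, B_path \<omega>))"
proof (rule pair_measure_eqI)
  note [measurable] = measurable_S[OF s]
  show "sigma_finite_measure (distr M borel (S s))"
    "sigma_finite_measure (distr M (\<Pi>\<^sub>M t\<in>{0..}. borel) B_path)"
    by (auto intro!: finite_measure.axioms(1) prob_space.axioms(1) prob_space_distr)
  fix A :: "real set" and C :: "(real \<Rightarrow> real ^ 'n) set"
  assume "A \<in> sets (distr M borel (S s))" "C \<in> sets (distr M (\<Pi>\<^sub>M t\<in>{0..}. borel) B_path)"
  then have [measurable]: "A \<in> sets borel" "C \<in> sets (\<Pi>\<^sub>M t\<in>{0..}. borel)"
    by simp_all
  show "emeasure (distr M borel (S s)) A * emeasure (distr M (\<Pi>\<^sub>M t\<in>{0..}. borel) B_path) C =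
      emeasure (distr M (borel \<Otimes>\<^sub>M (\<Pi>\<^sub>M t\<in>{0..}. borel)) (\<lambda>\<omega>. (S s \<omega>, B_path \<omega>))) (A \<times> C)"
    using indep_S_B_path[OF s, of A C]
    by (simp add: emeasure_distr vimage_def Int_def conj_commute)
qed (simp cong: sets_pair_measure_cong)

text \<open>Conditioning on the subordinator: by independence the pair of \<open>S s\<close> and the
  Brownian path has a product law, and Fubini integrates over the Brownian path with the random time
  frozen.\<close>

lemma emeasure_X_mod:
  assumes s: "0 \<le> s" and A [measurable]: "A \<in> sets borel"
  shows "emeasure M {\<omega>\<in>space M. X_mod s \<omega> \<in> A} =
    (\<integral>\<^sup>+\<omega>. emeasure M {\<omega>'\<in>space M. B (S s \<omega>) \<omega>' \<in> A} \<partial>M)"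
proof -
  note [measurable] = measurable_S[OF s]
  let ?P = "\<Pi>\<^sub>M t\<in>{0..}. (borel :: (real ^ 'n) measure)"
  interpret PB: prob_space "distr M ?P B_path" by (rule prob_space_distr) simp
  define C where "C = {x\<in>space (borel \<Otimes>\<^sub>M ?P). right_eval (snd x) (fst x) \<in> A}"
  have C: "C \<in> sets (borel \<Otimes>\<^sub>M ?P)"
  proof -
    have [measurable]: "(\<lambda>x. right_eval (snd x) (fst x)) \<in> borel_measurable (borel \<Otimes>\<^sub>M ?P)"
      by (rule borel_measurable_right_eval)
    show ?thesis unfolding C_def by measurable
  qed
  \<comment> \<open>At a frozen time \<open>r\<close>, continuity of the Brownian path lets
    \<open>right_eval\<close> be replaced by \<open>B r\<close> almost surely.\<close>
  have eq: "emeasure M {\<omega>'\<in>space M. right_eval (B_path \<omega>') r \<in> A} = emeasure M {\<omega>'\<in>space M. B r \<omega>' \<in> A}"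
    if "0 \<le> r" for r
  proof (rule emeasure_eq_AE)
    show "AE \<omega> in M. (\<omega> \<in> {\<omega>'\<in>space M. right_eval (B_path \<omega>') r \<in> A}) = (\<omega> \<in> {\<omega>'\<in>space M. B r \<omega>' \<in> A})"
      using AE_B_path by eventually_elim (use that in simp)
    have "(\<lambda>\<omega>. (r, B_path \<omega>)) \<in> M \<rightarrow>\<^sub>M borel \<Otimes>\<^sub>M ?P" by measurable
    from measurable_compose[OF this borel_measurable_right_eval]
    have [measurable]: "(\<lambda>\<omega>. right_eval (B_path \<omega>) r) \<in> borel_measurable M" by simp
    show "{\<omega>'\<in>space M. right_eval (B_path \<omega>') r \<in> A} \<in> sets M" by measurable
    show "{\<omega>'\<in>space M. B r \<omega>' \<in> A} \<in> sets M"
      using measurable_B[OF that] by measurable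
  qed
  have "emeasure M {\<omega>\<in>space M. X_mod s \<omega> \<in> A} = emeasure M {\<omega>\<in>space M. (S s \<omega>, B_path \<omega>) \<in> C}"
  proof (rule emeasure_eq_AE)
    show "AE \<omega> in M. (\<omega> \<in> {\<omega>\<in>space M. X_mod s \<omega> \<in> A}) = (\<omega> \<in> {\<omega>\<in>space M. (S s \<omega>, B_path \<omega>) \<in> C})"
      using AE_S_path AE_space
    proof eventually_elim
      case (elim \<omega>)
      then show ?case
        using s measurable_space[OF measurable_B_path, of \<omega>]
        by (simp add: X_mod_def C_def space_pair_measure)
    qed
    show "{\<omega>\<in>space M. X_mod s \<omega> \<in> A} \<in> sets M" by measurable
    show "{\<omega>\<in>space M. (S s \<omega>, B_path \<omega>) \<in> C} \<in> sets M" using C by measurable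
  qed
  also have "\<dots> = emeasure (distr M (borel \<Otimes>\<^sub>M ?P) (\<lambda>\<omega>. (S s \<omega>, B_path \<omega>))) C"
    using C by (simp add: emeasure_distr vimage_def Int_def conj_commute)
  also have "\<dots> = emeasure (distr M borel (S s) \<Otimes>\<^sub>M distr M ?P B_path) C"
    by (simp add: joint_law_S_B_path[OF s])
  also have "\<dots> = (\<integral>\<^sup>+r. emeasure (distr M ?P B_path) (Pair r -` C) \<partial>distr M borel (S s))"
    using C by (intro PB.emeasure_pair_measure_alt) (simp cong: sets_pair_measure_cong)
  also have "\<dots> = (\<integral>\<^sup>+\<omega>. emeasure (distr M ?P B_path) (Pair (S s \<omega>) -` C) \<partial>M)"
    using C by (intro nn_integral_distr) (auto cong: measurable_cong_sets sets_pair_measure_cong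
      intro!: PB.measurable_emeasure_Pair)
  also have "\<dots> = (\<integral>\<^sup>+\<omega>. emeasure M {\<omega>'\<in>space M. B (S s \<omega>) \<omega>' \<in> A} \<partial>M)"
  proof (rule nn_integral_cong_AE, use AE_S_path in eventually_elim)
    case (elim \<omega>)
    then have "0 \<le> S s \<omega>" using s by simp
    have "emeasure (distr M ?P B_path) (Pair (S s \<omega>) -` C) =
        emeasure M {\<omega>'\<in>space M. right_eval (B_path \<omega>') (S s \<omega>) \<in> A}"
      using measurable_space[OF measurable_B_path]
      by (subst emeasure_distr[OF measurable_B_path sets_Pair1[OF C]])
        (auto simp: C_def space_pair_measure intro!: arg_cong[where f = "emeasure M"])
    then show ?case using eq[OF \<open>0 \<le> S s \<omega>\<close>] by simp
  qed
  finally show ?thesis .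
qed

lemma distributed_B:
  assumes "0 < r"
  shows "distributed M lborel (B r) (\<lambda>x. ennreal (\<Prod>i\<in>UNIV. normal_density 0 (sqrt (2 * r)) (x $ i)))"
proof -
  have "distributed M lborel (\<lambda>\<omega>. B r \<omega> - B 0 \<omega>)
      (\<lambda>x. ennreal (\<Prod>i\<in>UNIV. normal_density 0 (sqrt (2 * r)) (x $ i)))"
    using brownian assms unfolding double_speed_brownian_def by force
  moreover have "distr M lborel (\<lambda>\<omega>. B r \<omega> - B 0 \<omega>) = distr M lborel (B r)"
    using AE_B_path measurable_B[of r] measurable_B[of 0] assms
    by (intro distr_cong_AE) (auto elim: eventually_mono)
  ultimately show ?thesis
    using measurable_B[of r] assms by (simp add: distributed_def)
qed

text \<open>Given \<open>S s = r > 0\<close>, the vector \<open>B r\<close> has a density and misses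
  the translated null set almost surely. Given \<open>S s = 0\<close>, which has positive
  probability when \<open>\<Psi>\<close> is bounded, the process is still at \<open>x\<close>; this
  is where \<open>x \<notin> N\<close> enters.\<close>

lemma X_mod_null:
  assumes s: "0 \<le> s" and N: "N \<in> null_sets lborel" and x: "x \<notin> N"
  shows "AE \<omega> in M. x + X_mod s \<omega> \<notin> N"
proof -
  define A where "A = {y. x + y \<in> N}"
  have A_null: "A \<in> null_sets lborel"
    using null_sets_translation[OF N, of "- x"] by (simp add: A_def add.commute)
  then have A: "A \<in> sets borel" by auto
  have "emeasure M {\<omega>'\<in>space M. B r \<omega>' \<in> A} = 0" if "0 \<le> r" for r
  proof (cases "r = 0")
    case True
    have "AE \<omega> in M. B r \<omega> \<notin> A"
      using AE_B_path by eventually_elim (use True x in \<open>simp add: A_def\<close>)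
    then show ?thesis
      using AE_iff_measurable[of "{\<omega>'\<in>space M. B r \<omega>' \<in> A}" M "\<lambda>\<omega>. B r \<omega> \<notin> A"]
        measurable_sets[OF measurable_B[OF that] A] by (simp add: vimage_def Int_def conj_commute)
  next
    case False
    with that have "0 < r" by simp
    have "emeasure M (B r -` A \<inter> space M) =
      (\<integral>\<^sup>+y. ennreal (\<Prod>i\<in>UNIV. normal_density 0 (sqrt (2 * r)) (y $ i)) * indicator A y \<partial>lborel)"
      by (rule distributed_emeasure[OF distributed_B[OF \<open>0 < r\<close>]]) (simp add: A)
    also have "\<dots> = (\<integral>\<^sup>+y. 0 \<partial>(lborel :: (real ^ 'n) measure))"
      by (intro nn_integral_cong_AE) (use AE_not_in[OF A_null] in \<open>auto elim: eventually_mono\<close>)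
    finally show ?thesis by (simp add: vimage_def Int_def conj_commute)
  qed
  then have "(\<integral>\<^sup>+\<omega>. emeasure M {\<omega>'\<in>space M. B (S s \<omega>) \<omega>' \<in> A} \<partial>M) = (\<integral>\<^sup>+\<omega>. 0 \<partial>M)"
    by (intro nn_integral_cong_AE) (use AE_S_path s in \<open>auto elim: eventually_mono\<close>)
  then have "emeasure M {\<omega>\<in>space M. X_mod s \<omega> \<in> A} = 0"
    using emeasure_X_mod[OF s A] by simp
  then have "AE \<omega> in M. X_mod s \<omega> \<notin> A"
    using A by (subst AE_iff_measurable[OF _ refl]) auto
  then show ?thesis by (simp add: A_def)
qed

section \<open>Escape across a hyperplane\<close>

lemma S_tail:
  assumes u: "0 < u" and t: "0 \<le> t"
  shows "1 - exp (1 - t * \<Psi> u) \<le> prob {\<omega>\<in>space M. 1 / u \<le> S t \<omega>}"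
proof -
  note [measurable] = measurable_S[OF t]
  have lap: "(\<integral>\<omega>. exp (- u * S t \<omega>) \<partial>M) = exp (- t * \<Psi> u)"
    using subordinator u t by (simp add: subordinator_def)
  \<comment> \<open>The integral of a non-integrable function is 0 by convention, whereas
    \<open>lap\<close> gives a positive value.\<close>
  have int: "integrable M (\<lambda>\<omega>. exp (- u * S t \<omega>))"
    using lap not_integrable_integral_eq by fastforce
  have "prob {\<omega>\<in>space M. exp (-1) \<le> exp (- u * S t \<omega>)} \<le> exp (- t * \<Psi> u) / exp (-1)"
    using integral_Markov_inequality_measure[OF int, of "space M" "exp (-1)"]
    unfolding lap by simp
  also have "\<dots> = exp (1 - t * \<Psi> u)"
    by (simp add: exp_diff[symmetric])
  finally have "prob {\<omega>\<in>space M. exp (-1) \<le> exp (- u * S t \<omega>)} \<le> exp (1 - t * \<Psi> u)" .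
  \<comment> \<open>\<open>S t < 1 / u\<close> means \<open>exp (- u * S t) > exp (-1)\<close>, so
    the Markov bound covers the event of a small subordinator.\<close>
  moreover have "prob {\<omega>\<in>space M. \<not> (1 / u \<le> S t \<omega>)} \<le> prob {\<omega>\<in>space M. exp (-1) \<le> exp (- u * S t \<omega>)}"
    using u by (intro finite_measure_mono) (auto simp: field_simps)
  moreover have "prob {\<omega>\<in>space M. \<not> (1 / u \<le> S t \<omega>)} = 1 - prob {\<omega>\<in>space M. 1 / u \<le> S t \<omega>}"
    by (rule prob_neg) measurable
  ultimately show ?thesis by linarith
qed

lemma B_halfspace:
  assumes r: "0 < r" and e: "norm e = 1" and R: "R \<le> sqrt r"
  shows "gauss2_cdf (-1) \<le> prob {\<omega>\<in>space M. R \<le> e \<bullet> B r \<omega>}"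
proof -
  note [measurable] = measurable_B[OF less_imp_le[OF r]]
  \<comment> \<open>Dividing by \<open>sqrt r\<close> normalises the variance \<open>2 * r\<close>
    to 2, and the minus sign turns the upper tail beyond \<open>sqrt r\<close> into the lower tail
    \<open>{..-1}\<close> that the distribution function measures.\<close>
  let ?w = "(- 1 / sqrt r) *\<^sub>R e"
  have "norm ?w * sqrt (2 * r) = sqrt 2" "?w \<noteq> 0"
    using r e by (auto simp: real_sqrt_mult)
  with distributed_normal_inner[OF distributed_B[OF r], of ?w] r
  have Z: "distributed M lborel (\<lambda>\<omega>. ?w \<bullet> B r \<omega>) (\<lambda>x. ennreal (normal_density 0 (sqrt 2) x))"
    by simp
  have "gauss2_cdf (-1) = measure (distr M lborel (\<lambda>\<omega>. ?w \<bullet> B r \<omega>)) {..-1}"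
    unfolding gauss2_cdf_def cdf_def distributed_distr_eq_density[OF Z] ..
  also have "\<dots> = prob ((\<lambda>\<omega>. ?w \<bullet> B r \<omega>) -` {..-1} \<inter> space M)"
    by (rule measure_distr) auto
  also have "\<dots> \<le> prob {\<omega>\<in>space M. R \<le> e \<bullet> B r \<omega>}"
    using r R by (intro finite_measure_mono) (auto simp: field_simps)
  finally show ?thesis .
qed

text \<open>Condition on \<open>S t\<close>. Where \<open>1 / u \<le> S t\<close>, the threshold
  \<open>1 / sqrt u\<close> is at most \<open>sqrt (S t)\<close>, so the Brownian half-space bound
  holds uniformly in the value of \<open>S t\<close>; elsewhere the conditional probability is
  bounded below by 0.\<close>

lemma X_mod_halfspace:
  assumes u: "0 < u" and e: "norm e = 1" and t: "0 \<le> t"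
  shows "prob {\<omega>\<in>space M. e \<bullet> X_mod t \<omega> < 1 / sqrt u} \<le>
    1 - gauss2_cdf (-1) * (1 - exp (1 - t * \<Psi> u))"
proof -
  note [measurable] = measurable_S[OF t]
  let ?A = "{y. 1 / sqrt u \<le> e \<bullet> y}"
  have A [measurable]: "?A \<in> sets borel"
    by (simp add: borel_closed closed_halfspace_ge)
  have "ennreal (gauss2_cdf (-1) * (1 - exp (1 - t * \<Psi> u)))
      \<le> ennreal (gauss2_cdf (-1) * prob {\<omega>\<in>space M. 1 / u \<le> S t \<omega>})"
    using S_tail[OF u t] gauss2_cdf_bounds by (intro ennreal_leI mult_left_mono) auto
  also have "\<dots> = (\<integral>\<^sup>+\<omega>. ennreal (gauss2_cdf (-1)) * indicator {\<omega>\<in>space M. 1 / u \<le> S t \<omega>} \<omega> \<partial>M)"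
    using gauss2_cdf_bounds by (simp add: nn_integral_cmult_indicator emeasure_eq_measure ennreal_mult)
  also have "\<dots> \<le> (\<integral>\<^sup>+\<omega>. emeasure M {\<omega>'\<in>space M. B (S t \<omega>) \<omega>' \<in> ?A} \<partial>M)"
  proof (rule nn_integral_mono)
    fix \<omega>
    have "ennreal (gauss2_cdf (-1)) \<le> emeasure M {\<omega>'\<in>space M. B (S t \<omega>) \<omega>' \<in> ?A}" if S: "1 / u \<le> S t \<omega>"
    proof -
      have pos: "0 < S t \<omega>" using S u by (smt (verit) divide_pos_pos)
      have "1 / sqrt u \<le> sqrt (S t \<omega>)"
        using real_sqrt_le_mono[OF S] by (simp add: real_sqrt_divide)
      from B_halfspace[OF pos e this] show ?thesis
        by (simp add: emeasure_eq_measure ennreal_leI)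
    qed
    then show "ennreal (gauss2_cdf (-1)) * indicator {\<omega>\<in>space M. 1 / u \<le> S t \<omega>} \<omega>
        \<le> emeasure M {\<omega>'\<in>space M. B (S t \<omega>) \<omega>' \<in> ?A}"
      by (auto simp: indicator_def)
  qed
  also have "\<dots> = ennreal (prob {\<omega>\<in>space M. X_mod t \<omega> \<in> ?A})"
    using emeasure_X_mod[OF t A] by (simp add: emeasure_eq_measure)
  finally have "gauss2_cdf (-1) * (1 - exp (1 - t * \<Psi> u)) \<le> prob {\<omega>\<in>space M. X_mod t \<omega> \<in> ?A}"
    by (subst (asm) ennreal_le_iff) auto
  moreover have "prob {\<omega>\<in>space M. \<not> X_mod t \<omega> \<in> ?A} = 1 - prob {\<omega>\<in>space M. X_mod t \<omega> \<in> ?A}"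
    by (rule prob_neg) measurable
  ultimately show ?thesis by (simp add: not_le)
qed

end


section \<open>Essential bounds and convex sets\<close>

text \<open>\<open>m\<close> is the essential supremum as a real number. The infimum of the
  essential bounds is itself one, because countably many null sets, one for each slack
  \<open>1 / Suc n\<close>, have a null union.\<close>

lemma AE_le_essential_bound:
  fixes f :: "'a \<Rightarrow> real"
  assumes bdd: "\<And>x. 0 \<le> f x \<and> f x \<le> K" and nz: "\<not> (AE x in M. f x = 0)"
  obtains m where "0 < m" "AE x in M. f x \<le> m" "\<And>c. c < m \<Longrightarrow> \<not> (AE x in M. f x \<le> c)"
proof -
  define C where "C = {c. 0 \<le> c \<and> (AE x in M. f x \<le> c)}"
  define m where "m = Inf C"
  have "0 \<le> K" using bdd[of undefined] by linarith
  then have "K \<in> C" using bdd by (simp add: C_def)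
  have bddC: "bdd_below C" by (rule bdd_belowI[of _ 0]) (simp add: C_def)
  have "0 \<le> m" unfolding m_def using \<open>K \<in> C\<close> by (intro cInf_greatest) (auto simp: C_def)
  have "AE x in M. f x \<le> m + 1 / real (Suc n)" for n
  proof -
    have "Inf C < m + 1 / real (Suc n)" by (simp add: m_def)
    then obtain c where "c \<in> C" "c < m + 1 / real (Suc n)"
      using cInf_lessD[of C] \<open>K \<in> C\<close> by auto
    then show ?thesis by (auto simp: C_def elim!: eventually_mono)
  qed
  then have "AE x in M. \<forall>n. f x \<le> m + 1 / real (Suc n)" by (simp add: AE_all_countable)
  then have AE: "AE x in M. f x \<le> m"
  proof eventually_elim
    case (elim x)
    show ?case
    proof (rule field_le_epsilon)
      fix e :: real assume "0 < e"
      then obtain n where "1 / real (Suc n) < e"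
        using reals_Archimedean by (auto simp: inverse_eq_divide)
      with elim[rule_format, of n] show "f x \<le> m + e" by simp
    qed
  qed
  have "0 < m"
  proof (rule ccontr)
    assume "\<not> 0 < m"
    from AE have "AE x in M. f x = 0"
    proof eventually_elim
      case (elim x)
      with bdd[of x] \<open>\<not> 0 < m\<close> show ?case by linarith
    qed
    with nz show False by simp
  qed
  moreover have "\<not> (AE x in M. f x \<le> c)" if "c < m" for c
  proof
    assume "AE x in M. f x \<le> c"
    then have "AE x in M. f x \<le> max c 0" by eventually_elim simp
    then have "max c 0 \<in> C" by (simp add: C_def)
    then have "m \<le> max c 0" unfolding m_def by (rule cInf_lower[OF _ bddC])
    with that \<open>0 < m\<close> show False by simp
  qed
  ultimately show ?thesis using AE that by blast
qed

text \<open>\<open>real_of_ereal\<close> sends infinite values to 0; the bounds 0 and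
  \<open>C\<close> keep the essential supremum finite, so that the conversion loses nothing.\<close>

lemma AE_abs_le_Linfty_norm:
  assumes [measurable]: "f \<in> borel_measurable borel" and C: "AE x in lborel. \<bar>f x\<bar> \<le> C"
  shows "AE x in lborel. \<bar>f x\<bar> \<le> Linfty_norm f"
proof -
  define E where "E = esssup lborel (\<lambda>x. ereal \<bar>f x\<bar>)"
  have "E \<le> ereal C" unfolding E_def using C by (intro esssup_I) auto
  moreover have "0 \<le> E"
    using esssup_mono[of "\<lambda>_. 0" lborel "\<lambda>x. ereal \<bar>f x\<bar>"] by (simp add: E_def esssup_const)
  ultimately have "E = ereal (Linfty_norm f)"
    unfolding Linfty_norm_def E_def[symmetric] by (cases E) auto
  with esssup_AE[of "\<lambda>x. ereal \<bar>f x\<bar>" lborel] show ?thesis by (simp add: E_def)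
qed

text \<open>Finiteness again justifies \<open>real_of_ereal\<close>: nonnegativity of
  \<open>f\<close> bounds \<open>E\<close> above by 0, and positive measure of \<open>D\<close>
  together with \<open>C\<close> bounds it below, since over a null set \<open>E\<close> would be
  minus infinity.\<close>

lemma AE_ess_inf_on_le:
  assumes [measurable]: "f \<in> borel_measurable borel" "D \<in> sets borel" and D: "emeasure lborel D \<noteq> 0"
    and nonneg: "\<And>x. 0 \<le> f x" and C: "AE x in lborel. f x \<le> C"
  shows "AE x in lborel. x \<in> D \<longrightarrow> ess_inf_on D f \<le> f x"
proof -
  let ?R = "restrict_space lborel D"
  define E where "E = esssup ?R (\<lambda>x. - ereal (f x))"
  have "(\<lambda>x. - ereal (f x)) \<in> borel_measurable ?R" by (intro measurable_restrict_space1) measurable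
  then have "E \<le> 0" unfolding E_def using nonneg by (intro esssup_I) auto
  have AE_R: "(AE x in ?R. P x) \<longleftrightarrow> (AE x in lborel. x \<in> D \<longrightarrow> P x)" for P
    by (rule AE_restrict_space_iff) auto
  have "esssup ?R (\<lambda>_. - ereal C) \<le> E"
    unfolding E_def using C by (intro esssup_AE_mono) (auto simp: AE_R elim: eventually_mono)
  moreover have "emeasure ?R (space ?R) \<noteq> 0"
    using D by (simp add: space_restrict_space emeasure_restrict_space)
  ultimately have "- ereal C \<le> E" by (simp add: esssup_const)
  with \<open>E \<le> 0\<close> have "E = ereal (- ess_inf_on D f)"
    unfolding ess_inf_on_def E_def[symmetric] by (cases E) auto
  moreover have "AE x in lborel. x \<in> D \<longrightarrow> - ereal (f x) \<le> E"
    using esssup_AE[of "\<lambda>x. - ereal (f x)" ?R] by (simp add: E_def AE_R)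
  ultimately show ?thesis by (auto elim!: eventually_mono)
qed

text \<open>The ball about \<open>x\<close> of radius \<open>1 / sqrt u\<close> has larger volume
  than \<open>D\<close>, so it contains a point \<open>z\<close> outside \<open>D\<close>. A
  hyperplane separating \<open>z\<close> from \<open>D\<close> is at distance at most
  \<open>norm (z - x)\<close> from \<open>x\<close>; strictness comes from the ball being
  open.\<close>

lemma convex_small_volume_halfspace:
  fixes D :: "(real ^ 'n) set"
  assumes D: "convex D" "open D" "x \<in> D" and u: "0 < u"
    and vol: "emeasure lborel D * ennreal (u powr (real CARD('n) / 2)) < emeasure lborel (ball (0 :: real ^ 'n) 1)"
  obtains e where "norm e = 1" "\<And>y. y \<in> D \<Longrightarrow> e \<bullet> (y - x) < 1 / sqrt u"
proof -
  have "\<not> ball x (1 / sqrt u) \<subseteq> D"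
  proof
    assume "ball x (1 / sqrt u) \<subseteq> D"
    then have le: "emeasure lborel (ball x (1 / sqrt u)) \<le> emeasure lborel D"
      using D by (intro emeasure_mono) auto
    have pow: "(1 / sqrt u) ^ CARD('n) * u powr (real CARD('n) / 2) = 1"
    proof -
      have "u powr (real CARD('n) / 2) = sqrt u ^ CARD('n)"
        using u by (simp add: powr_half_sqrt[symmetric] powr_powr powr_realpow[symmetric])
      then show ?thesis using u by (simp add: power_divide)
    qed
    have "emeasure lborel (ball (0 :: real ^ 'n) 1) =
        ennreal (unit_ball_vol (real CARD('n)) * ((1 / sqrt u) ^ CARD('n) * u powr (real CARD('n) / 2)))"
      unfolding pow by (simp add: emeasure_ball)
    also have "\<dots> = emeasure lborel (ball x (1 / sqrt u)) * ennreal (u powr (real CARD('n) / 2))"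
      using u by (simp add: emeasure_ball ennreal_mult[symmetric] mult.assoc)
    also have "\<dots> \<le> emeasure lborel D * ennreal (u powr (real CARD('n) / 2))"
      by (intro mult_right_mono le) simp
    finally show False using vol by simp
  qed
  then obtain z where z: "z \<in> ball x (1 / sqrt u)" "z \<notin> D" by blast
  then obtain a b where ab: "a \<noteq> 0" "\<And>y. y \<in> D \<Longrightarrow> a \<bullet> y \<le> b" "b \<le> a \<bullet> z"
    using separating_hyperplane_sets[OF D(1), of "{z}"] D(3) by auto
  show ?thesis
  proof
    show "norm (a /\<^sub>R norm a) = 1" using ab(1) by simp
    fix y assume "y \<in> D"
    then have "a \<bullet> (y - x) \<le> a \<bullet> (z - x)" using ab(2)[of y] ab(3) by (simp add: inner_diff_right)
    also have "\<dots> \<le> norm a * norm (z - x)" by (rule norm_cauchy_schwarz)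
    also have "\<dots> < norm a * (1 / sqrt u)"
      using z(1) ab(1) by (intro mult_strict_left_mono) (auto simp: dist_norm norm_minus_commute)
    finally show "(a /\<^sub>R norm a) \<bullet> (y - x) < 1 / sqrt u"
      using ab(1) by (simp add: field_simps)
  qed
qed

section \<open>The eigenvalue bound\<close>

lemma exit_time_gtD: "exit_time D p > ereal t \<Longrightarrow> 0 < s \<Longrightarrow> s \<le> t \<Longrightarrow> p s \<in> D"
proof (rule ccontr)
  assume *: "exit_time D p > ereal t" "0 < s" "s \<le> t" "p s \<notin> D"
  then have "exit_time D p \<le> ereal s" unfolding exit_time_def by (intro Inf_lower) auto
  also have "\<dots> \<le> ereal t" using * by simp
  finally show False using * by simp
qed

context subordinate_brownian
begin

text \<open>\<open>N\<close> collects the exceptional points of the bounds on \<open>\<phi>\<close>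
  and \<open>V\<close>. Almost every path avoids \<open>N\<close> at time \<open>t\<close> and at
  almost all earlier times, which is enough for the endpoint and for the time integral. A path that
  survives stays in \<open>D\<close>, so its exponential weight is at most
  \<open>exp (v * t)\<close> and its endpoint lies in \<open>D\<close>.\<close>

lemma killed_feynman_kac_le:
  fixes D :: "(real ^ 'n) set" and V \<phi> :: "real ^ 'n \<Rightarrow> real"
  assumes [measurable]: "V \<in> borel_measurable borel" and D [measurable]: "D \<in> sets borel"
    and t: "0 < t" and m: "0 \<le> m"
    and N: "N \<in> null_sets lborel" "x \<notin> N"
    and \<phi>: "\<And>y. y \<notin> N \<Longrightarrow> \<bar>\<phi> y\<bar> \<le> m"
    and V: "\<And>y. y \<notin> N \<Longrightarrow> \<bar>V y\<bar> \<le> C" "\<And>y. y \<notin> N \<Longrightarrow> y \<in> D \<Longrightarrow> - v \<le> V y"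
  shows "\<bar>killed_feynman_kac M (subordinated B S) D V t \<phi> x\<bar> \<le>
    exp (v * t) * m * prob {\<omega>\<in>space M. x + X_mod t \<omega> \<in> D}"
proof -
  note X_mod_meas [measurable] = measurable_X_mod
  define A where "A = {\<omega>\<in>space M. x + X_mod t \<omega> \<in> D}"
  have A [measurable]: "A \<in> sets M" unfolding A_def by measurable
  define F where "F \<omega> = exp (- (LINT s:{0..t}|lborel. V (x + subordinated B S s \<omega>))) *
      \<phi> (x + subordinated B S t \<omega>) *
      indicator {\<omega>. exit_time D (\<lambda>s. x + subordinated B S s \<omega>) > ereal t} \<omega>" for \<omega>
  have [measurable]: "N \<in> sets borel" using N(1) by auto
  interpret pair_sigma_finite "lborel :: real measure" M ..
  have "AE s in lborel. AE \<omega> in M. 0 \<le> s \<longrightarrow> x + X_mod s \<omega> \<notin> N"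
    by (rule AE_I2, rule AE_impI, rule X_mod_null[OF _ N])
  \<comment> \<open>Fubini exchanges the quantifiers: from almost surely at each time to, almost
    surely, at almost all times. Joint measurability of \<open>X_mod\<close> is what permits
    this.\<close>
  then have AE_path: "AE \<omega> in M. AE s in lborel. 0 \<le> s \<longrightarrow> x + X_mod s \<omega> \<notin> N"
    by (subst (asm) AE_commute) measurable
  have "AE \<omega> in M. \<bar>F \<omega>\<bar> \<le> exp (v * t) * m * indicator A \<omega>"
    using AE_X_mod AE_path X_mod_null[OF less_imp_le[OF t] N] AE_space
  proof eventually_elim
    case (elim \<omega>)
    show ?case
    proof (cases "exit_time D (\<lambda>s. x + subordinated B S s \<omega>) > ereal t")
      case False
      then show ?thesis using m by (simp add: F_def)
    next
      case True
      have inD: "x + X_mod s \<omega> \<in> D" if "0 < s" "s \<le> t" for s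
        using exit_time_gtD[OF True that] elim(1) that by simp
      have [measurable]: "(\<lambda>s. X_mod s \<omega>) \<in> borel_measurable borel"
        using measurable_compose[OF measurable_Pair2' X_mod_meas, of \<omega>] elim(4) by simp
      have "- v * t = (LINT s:{0..t}|lborel. - v)"
        using t by (simp add: set_lebesgue_integral_def)
      also have "\<dots> \<le> (LINT s:{0..t}|lborel. V (x + X_mod s \<omega>))"
        unfolding set_lebesgue_integral_def
      proof (rule integral_mono_AE)
        show "integrable lborel (\<lambda>s. indicat_real {0..t} s *\<^sub>R V (x + X_mod s \<omega>))"
        proof (rule integrableI_bounded_set_indicator)
          show "AE s in lborel. s \<in> {0..t} \<longrightarrow> norm (V (x + X_mod s \<omega>)) \<le> C"
            using elim(2) by eventually_elim (use V(1) in auto)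
          show "emeasure lborel {0..t} < \<infinity>" using t by simp
        qed auto
        show "integrable lborel (\<lambda>s. indicat_real {0..t} s *\<^sub>R - v)"
          using t by (intro integrable_scaleR_left integrable_real_indicator) simp_all
        \<comment> \<open>The exit time controls the path only at strictly positive times, so time 0
          is discarded as a null set.\<close>
        show "AE s in lborel. indicat_real {0..t} s *\<^sub>R - v \<le> indicat_real {0..t} s *\<^sub>R V (x + X_mod s \<omega>)"
          using elim(2) AE_lborel_singleton[of "0 :: real"]
          by eventually_elim (use V(2) inD in \<open>auto simp: indicator_def\<close>)
      qed
      also have "\<dots> = (LINT s:{0..t}|lborel. V (x + subordinated B S s \<omega>))"
        using elim(1) by (intro set_lebesgue_integral_cong) auto
      finally have "exp (- (LINT s:{0..t}|lborel. V (x + subordinated B S s \<omega>))) \<le> exp (v * t)"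
        by simp
      moreover have "\<bar>\<phi> (x + subordinated B S t \<omega>)\<bar> \<le> m"
        using \<phi>[OF elim(3)] elim(1) t by simp
      ultimately have "\<bar>F \<omega>\<bar> \<le> exp (v * t) * m"
        using True by (simp add: F_def abs_mult mult_mono)
      then show ?thesis using inD[of t] t elim(4) by (simp add: A_def)
    qed
  qed
  then have bound: "AE \<omega> in completion M. \<bar>F \<omega>\<bar> \<le> exp (v * t) * m * indicator A \<omega>"
    by (rule AE_completion)
  have A': "A \<in> sets (completion M)" using A by (rule sets_completionI_sets)
  have "\<bar>\<integral>\<omega>. F \<omega> \<partial>completion M\<bar> \<le> exp (v * t) * m * prob A"
  \<comment> \<open>Measurability of \<open>F\<close> is not established here: if \<open>F\<close>
    is not integrable, its integral is 0 and the bound holds trivially.\<close>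
  proof (cases "integrable (completion M) F")
    case True
    interpret cM: finite_measure "completion M"
      by standard (simp add: emeasure_completion emeasure_eq_measure)
    have "\<bar>\<integral>\<omega>. F \<omega> \<partial>completion M\<bar> \<le> (\<integral>\<omega>. \<bar>F \<omega>\<bar> \<partial>completion M)"
      by (rule integral_abs_bound)
    also have "\<dots> \<le> (\<integral>\<omega>. exp (v * t) * m * indicator A \<omega> \<partial>completion M)"
      using True bound A' by (intro integral_mono_AE) (auto simp: cM.emeasure_eq_measure)
    also have "\<dots> = exp (v * t) * m * prob A"
      using A A' by (simp add: measure_completion)
    finally show ?thesis .
  next
    case False
    then show ?thesis using m by (simp add: not_integrable_integral_eq)
  qed
  then show ?thesis by (simp add: killed_feynman_kac_def F_def A_def)
qed

text \<open>The argument runs at points where \<open>\<bar>\<phi>\<bar>\<close> is close to its essential supremum, not at a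
  maximiser: if \<open>\<Psi>\<close> is bounded, the process rests at its starting point with positive probability,
  so \<open>\<phi>\<close> at a single point depends on the value of \<open>V\<close> there, which the essential bounds do not
  control.\<close>

lemma eigenvalue_lower_bound:
  fixes D :: "(real ^ 'n) set" and V \<phi> :: "real ^ 'n \<Rightarrow> real"
  assumes V: "in_Linfty V" "AE y in lborel. y \<in> D \<longrightarrow> - v \<le> V y"
    and D: "open D" "convex D"
    and eigen: "dirichlet_eigenfunction M (subordinated B S) D V lam \<phi>"
    and bdd: "\<And>y. \<bar>\<phi> y\<bar> \<le> K"
    and u: "0 < u" "0 < \<Psi> u"
    and vol: "emeasure lborel D * ennreal (u powr (real CARD('n) / 2)) < emeasure lborel (ball (0 :: real ^ 'n) 1)"
  shows "theta * \<Psi> u \<le> v + lam"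
proof -
  have Dmeas: "D \<in> sets borel" using D(1) by simp
  have nz: "\<not> (AE x in lborel. \<bar>\<phi> x\<bar> = 0)"
  proof
    assume "AE x in lborel. \<bar>\<phi> x\<bar> = 0"
    then have "AE x in lborel. x \<in> D \<longrightarrow> \<phi> x = 0" by eventually_elim simp
    with eigen show False by (simp add: dirichlet_eigenfunction_def)
  qed
  obtain m where m: "0 < m" "AE x in lborel. \<bar>\<phi> x\<bar> \<le> m"
      "\<And>c. c < m \<Longrightarrow> \<not> (AE x in lborel. \<bar>\<phi> x\<bar> \<le> c)"
    using AE_le_essential_bound[of "\<lambda>x. \<bar>\<phi> x\<bar>" K lborel] bdd nz by auto
  obtain C where [measurable]: "V \<in> borel_measurable borel" and C: "AE x in lborel. \<bar>V x\<bar> \<le> C"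
    using V(1) by (auto simp: in_Linfty_def)
  have "AE y in lborel. \<bar>\<phi> y\<bar> \<le> m \<and> \<bar>V y\<bar> \<le> C \<and> (y \<in> D \<longrightarrow> - v \<le> V y)"
    using m(2) C V(2) by eventually_elim simp
  then obtain N where N: "N \<in> null_sets lborel"
      "\<And>y. y \<notin> N \<Longrightarrow> \<bar>\<phi> y\<bar> \<le> m \<and> \<bar>V y\<bar> \<le> C \<and> (y \<in> D \<longrightarrow> - v \<le> V y)"
    by (rule AE_E3) auto
  obtain \<kappa> where \<kappa>: "1 < \<kappa>" "theta = - theta_fun \<kappa>"
    using theta_attained by metis
  \<comment> \<open>\<open>q\<close> will bound the probability of being in \<open>D\<close> at time
    \<open>t\<close>; the choice of \<open>\<kappa>\<close> makes it equal to
    \<open>exp (- (\<kappa> * theta))\<close>.\<close>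
  define q where "q = 1 - gauss2_cdf (-1) * (1 - exp (1 - \<kappa>))"
  have "gauss2_cdf (-1) * (1 - exp (1 - \<kappa>)) < 1 * 1"
    using gauss2_cdf_bounds \<kappa>(1) by (intro mult_strict_mono') auto
  then have q: "0 < q" by (simp add: q_def)
  have "- (\<kappa> * theta) = ln q"
    using \<kappa>(1) by (simp add: \<kappa>(2) theta_fun_def q_def)
  with q have q_eq: "q = exp (- (\<kappa> * theta))" by simp
  define t where "t = \<kappa> / \<Psi> u"
  have t: "0 < t" "t * \<Psi> u = \<kappa>" using \<kappa>(1) u by (simp_all add: t_def)
  \<comment> \<open>Since \<open>c\<close> is below the essential supremum, some point outside
    \<open>N\<close> has \<open>\<bar>\<phi> x\<bar> > c\<close>; it lies in \<open>D\<close>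
    because \<open>c > 0\<close> and \<open>\<phi>\<close> vanishes elsewhere.\<close>
  have "c \<le> exp (lam * t) * (exp (v * t) * m * q)" if c: "0 < c" "c < m" for c
  proof -
    obtain x where x: "x \<notin> N" "c < \<bar>\<phi> x\<bar>"
    proof (rule ccontr)
      assume "\<not> thesis"
      with that have "\<And>x. x \<notin> N \<Longrightarrow> \<bar>\<phi> x\<bar> \<le> c" by (meson not_le)
      then have "AE x in lborel. \<bar>\<phi> x\<bar> \<le> c"
        using AE_not_in[OF N(1)] by (auto elim: eventually_mono)
      with m(3) c show False by blast
    qed
    have "x \<in> D" using x(2) c(1) eigen by (auto simp: dirichlet_eigenfunction_def)
    obtain e where e: "norm e = 1" "\<And>y. y \<in> D \<Longrightarrow> e \<bullet> (y - x) < 1 / sqrt u"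
      using convex_small_volume_halfspace[OF D(2,1) \<open>x \<in> D\<close> u(1) vol] by blast
    have "prob {\<omega>\<in>space M. x + X_mod t \<omega> \<in> D} \<le> prob {\<omega>\<in>space M. e \<bullet> X_mod t \<omega> < 1 / sqrt u}"
    proof (rule finite_measure_mono)
      show "{\<omega>\<in>space M. e \<bullet> X_mod t \<omega> < 1 / sqrt u} \<in> sets M" by measurable
    qed (use e(2) in force)
    also have "\<dots> \<le> q"
      using X_mod_halfspace[OF u(1) e(1), of t] t by (simp add: q_def)
    finally have escape: "prob {\<omega>\<in>space M. x + X_mod t \<omega> \<in> D} \<le> q" .
    have "exp (- lam * t) * \<bar>\<phi> x\<bar> = \<bar>killed_feynman_kac M (subordinated B S) D V t \<phi> x\<bar>"
      using eigen t(1) \<open>x \<in> D\<close> by (simp add: dirichlet_eigenfunction_def abs_mult)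
    also have "\<dots> \<le> exp (v * t) * m * prob {\<omega>\<in>space M. x + X_mod t \<omega> \<in> D}"
      using N(2) by (intro killed_feynman_kac_le[OF _ Dmeas t(1) less_imp_le[OF m(1)] N(1) x(1)]) auto
    also have "\<dots> \<le> exp (v * t) * m * q"
      using escape m(1) by (intro mult_left_mono) auto
    finally have "\<bar>\<phi> x\<bar> \<le> exp (lam * t) * (exp (v * t) * m * q)"
      by (simp add: exp_minus field_simps)
    with x(2) show ?thesis by simp
  qed
  \<comment> \<open>Letting \<open>c\<close> increase to \<open>m\<close> puts the same
    \<open>m > 0\<close> on both sides; after cancellation only an inequality between exponents is
    left.\<close>
  then have "m \<le> exp (lam * t) * (exp (v * t) * m * q)"
    by (rule dense_le_bounded[OF m(1)])
  also have "\<dots> = m * exp ((v + lam) * t - \<kappa> * theta)"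
    by (simp add: q_eq exp_add exp_diff exp_minus ring_distribs field_simps)
  finally have "0 \<le> (v + lam) * t - \<kappa> * theta" using m(1) by simp
  then have "\<kappa> * (theta * \<Psi> u) \<le> \<kappa> * (v + lam)"
    using u by (simp add: t_def field_simps)
  then show ?thesis using \<kappa>(1) by simp
qed

end

section \<open>Passage from the eigenvalue bound to the inverse of \<Psi>\<close>

theorem corollary3p5:
  fixes M :: "'w measure"
    and \<Psi> :: "real \<Rightarrow> real"
    and S :: "real \<Rightarrow> 'w \<Rightarrow> real"
    and B :: "real \<Rightarrow> 'w \<Rightarrow> real ^ 'n"
    and V :: "real ^ 'n \<Rightarrow> real"
    and D :: "(real ^ 'n) set"
    and \<phi> :: "real ^ 'n \<Rightarrow> real"
    and lam :: real
    and x_max :: "real ^ 'n"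
  assumes "bernstein0 \<Psi>" and "strict_mono_on {0<..} \<Psi>"
    and "prob_space M"
    and "subordinator M \<Psi> S" and "double_speed_brownian M B" and "indep_processes M S B"
    and "in_Linfty V"
    and "open D" and "bounded D" and "convex D"
    and "dirichlet_eigenfunction M (subordinated B S) D V lam \<phi>"
    and "x_max \<in> D" and "\<And>y. \<bar>\<phi> y\<bar> \<le> \<bar>\<phi> x_max\<bar>"
  shows "emeasure lborel D *
           ennreal_powr
             (bernstein_inv \<Psi>
               ((Linfty_norm (\<lambda>x. max (- V x) 0) - ess_inf_on D (\<lambda>x. max (V x) 0) + lam) / theta))
             (real CARD('n) / 2)
         \<ge> emeasure lborel (ball (0 :: real ^ 'n) 1)"
proof -
  interpret subordinate_brownian M \<Psi> S B
    using assms(3-6) by (simp add: subordinate_brownian_def subordinate_brownian_axioms_def)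
  define v where "v = Linfty_norm (\<lambda>x. max (- V x) 0) - ess_inf_on D (\<lambda>x. max (V x) 0)"
  let ?a = "(v + lam) / theta" and ?d = "real CARD('n) / 2"
  let ?\<omega> = "emeasure lborel (ball (0 :: real ^ 'n) 1)"
  have \<omega>: "0 < ?\<omega>" by (simp add: emeasure_ball)
  have D_pos: "emeasure lborel D \<noteq> 0"
    using open_not_negligible[OF assms(8)] assms(8,12)
    by (auto simp: negligible_iff_null_sets null_sets_completion_iff null_sets_def)
  have D_fin: "emeasure lborel D < \<infinity>"
    using assms(9) by (rule emeasure_bounded_finite)
  obtain C where [measurable]: "V \<in> borel_measurable borel" and C: "AE x in lborel. \<bar>V x\<bar> \<le> C"
    using assms(7) by (auto simp: in_Linfty_def)
  have "AE x in lborel. \<bar>max (- V x) 0\<bar> \<le> Linfty_norm (\<lambda>x. max (- V x) 0)"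
    by (rule AE_abs_le_Linfty_norm[where C = C]) (use C in \<open>auto elim: eventually_mono\<close>)
  moreover have "AE x in lborel. x \<in> D \<longrightarrow> ess_inf_on D (\<lambda>x. max (V x) 0) \<le> max (V x) 0"
    by (rule AE_ess_inf_on_le[where C = C]) (use C D_pos assms(8) in \<open>auto elim: eventually_mono\<close>)
  \<comment> \<open>\<open>V\<close> is its positive part minus its negative part; the first is
    bounded below on \<open>D\<close>, the second above.\<close>
  ultimately have v: "AE x in lborel. x \<in> D \<longrightarrow> - v \<le> V x"
    by eventually_elim (auto simp: v_def)
  have \<Psi>_pos: "0 < \<Psi> u" if "0 < u" for u
  proof -
    have "0 \<le> \<Psi> (u / 2)" using assms(1) that by (simp add: bernstein0_def)
    also have "\<dots> < \<Psi> u" using strict_mono_onD[OF assms(2), of "u / 2" u] that by simp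
    finally show ?thesis .
  qed
  have theta_pos: "0 < theta"
  proof -
    obtain \<kappa> where "theta = - theta_fun \<kappa>" "theta_fun \<kappa> \<le> theta_fun 2"
      using theta_attained by (metis one_less_numeral_iff semiring_norm(76))
    moreover have "theta_fun 2 < 0"
    proof -
      have "gauss2_cdf (-1) * (1 - exp (1 - 2)) < 1 * 1"
        using gauss2_cdf_bounds by (intro mult_strict_mono') auto
      moreover have "0 < gauss2_cdf (-1) * (1 - exp (1 - 2))"
        using gauss2_cdf_bounds by simp
      ultimately show ?thesis by (simp add: theta_fun_def)
    qed
    ultimately show ?thesis by simp
  qed
  have key: "\<Psi> u \<le> ?a" if "0 < u" "emeasure lborel D * ennreal (u powr ?d) < ?\<omega>" for u
    using eigenvalue_lower_bound[OF assms(7) v assms(8,10,11,13) that(1) \<Psi>_pos[OF that(1)] that(2)] theta_pos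
    by (simp add: field_simps)
  \<comment> \<open>The volume condition is strict and continuous in \<open>u\<close>, so it
    survives a small increase of \<open>u\<close>. The value \<open>\<eta> = 0\<close> is allowed
    because the exponent \<open>?d\<close> is positive.\<close>
  have dense: "\<exists>u>\<eta>. emeasure lborel D * ennreal (u powr ?d) < ?\<omega>"
    if "0 \<le> \<eta>" "emeasure lborel D * ennreal (\<eta> powr ?d) < ?\<omega>" for \<eta>
  proof -
    let ?f = "\<lambda>u. measure lborel D * u powr ?d"
    have eq: "emeasure lborel D * ennreal (u powr ?d) = ennreal (?f u)" for u
      using D_fin by (simp add: emeasure_eq_ennreal_measure ennreal_mult)
    have \<omega>_eq: "?\<omega> = ennreal (unit_ball_vol (real CARD('n)))"
      by (simp add: emeasure_ball)
    have "(?f \<longlongrightarrow> ?f \<eta>) (at_right \<eta>)"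
      using that(1) by (intro tendsto_intros) (auto simp: eventually_at_filter)
    moreover have "?f \<eta> < unit_ball_vol (real CARD('n))"
      using that(2) unfolding eq \<omega>_eq by (subst (asm) ennreal_less_iff) auto
    ultimately have "\<forall>\<^sub>F u in at_right \<eta>. ?f u < unit_ball_vol (real CARD('n)) \<and> \<eta> < u"
      by (auto intro: eventually_conj order_tendstoD eventually_at_right_less)
    then obtain u where "?f u < unit_ball_vol (real CARD('n))" "\<eta> < u"
      using eventually_happens'[OF trivial_limit_at_right_real] by blast
    then show ?thesis unfolding eq \<omega>_eq by (auto simp: ennreal_less_iff)
  qed
  show ?thesis
  proof (rule ccontr)
    assume "\<not> ?thesis"
    then have less: "emeasure lborel D * ennreal_powr (bernstein_inv \<Psi> ?a) ?d < ?\<omega>"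
      by (simp add: v_def not_le)
    show False
    proof (cases "?a \<in> \<Psi> ` {0<..}")
      case True
      then obtain \<eta> where \<eta>: "0 < \<eta>" "?a = \<Psi> \<eta>" by auto
      have "bernstein_inv \<Psi> ?a = ennreal \<eta>"
        using \<eta> the_inv_into_f_f[OF strict_mono_on_imp_inj_on[OF assms(2)], of \<eta>]
        by (simp add: bernstein_inv_def)
      with less \<eta>(1) obtain u where "\<eta> < u" "emeasure lborel D * ennreal (u powr ?d) < ?\<omega>"
        using dense[of \<eta>] by (auto simp: ennreal_powr_def)
      \<comment> \<open>Here \<open>key\<close> gives \<open>\<Psi> u \<le> \<Psi> \<eta>\<close>
        although \<open>\<eta> < u\<close>.\<close>
      with key[of u] strict_mono_onD[OF assms(2), of \<eta> u] \<eta> show False by simp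
    next
      case False
      show False
      proof (cases "?a \<le> 0")
        case True
        \<comment> \<open>This case cannot occur: every small \<open>u > 0\<close> meets the volume
          condition, and \<open>key\<close> would force \<open>\<Psi> u \<le> 0\<close>.\<close>
        obtain u where "0 < u" "emeasure lborel D * ennreal (u powr ?d) < ?\<omega>"
          using dense[of 0] \<omega> by auto
        with key[of u] \<Psi>_pos[of u] True show False by simp
      next
        case nonpos: False
        \<comment> \<open>A positive argument outside the range lies above it; the inverse is
          infinite, and as \<open>D\<close> has positive measure the product is infinite
          too.\<close>
        then have "bernstein_inv \<Psi> ?a = \<infinity>" using False by (simp add: bernstein_inv_def)
        with less D_pos show False by (simp add: ennreal_powr_def ennreal_mult_top)
      qed
    qed
  qed
qed

end
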